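(* Let $(\mathcal V,\mathcal E)$ be a connected, acyclic, undirected graph on $n$ nodes with edge weights $b_{ij}>0$, and let $E\in\mathbb{R}^{n\times(n-1)}$ be its (weighted) incidence matrix, so that $L=EE^{\top}$ is the weighted graph Laplacian. Let $m,d,k,b,\tau_\mu>0$ and put $M=mI_n$, $D=dI_n$, $K=kI_n$, $B_1=bI_n$, $R=\frac1n I_n$. Consider the linear system $G$ with state $(\varphi,\omega,\mu)\in\mathbb{R}^{n-1}\times\mathbb{R}^n\times\mathbb{R}$, input $\eta\in\mathbb{R}^n$ and output $y\in\mathbb{R}^n$: $$\dot\varphi=E^{\top}\omega,\qquad M\dot\omega=-E\varphi-D\omega-K^{-1}\mathbf 1_n\,\mu+B_1\eta,\qquad \tau_\mu\dot\mu=\mathbf 1_n^{\top}R\,\omega,\qquad y=-K^{-1/2}\mathbf 1_n\,\mu .$$ Then the squared $\mathcal H_2$ norm of $G$ is $$\|G\|_{\mathcal H_2}^2=\frac{b^2}{2\tau_\mu}\,\frac1d .$$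
   Context: $\mathbf 1_n\in\mathbb{R}^n$ is the all-ones vector. The weighted incidence matrix $E$ has one column per edge; after fixing an arbitrary orientation, the column of edge $\{i,j\}$ is $\sqrt{b_{ij}}\,(e_i-e_j)$, where $e_i$ are the standard basis vectors, so that $EE^\top=L$. $\mathcal H_2$ norm: for an input-output stable linear system $\dot x=Ax+B\eta$, $y=Cx$, $\|G\|_{\mathcal H_2}^2=\lim_{t\to\infty}\mathbb E[y(t)^\top y(t)]$ when $\eta$ is white noise with $\mathbb E[\eta(t)\eta(\tau)^\top]=\delta(t-\tau)I$; equivalently $\|G\|_{\mathcal H_2}^2=\int_0^\infty \mathrm{Tr}\big(B^\top e^{A^\top t}C^\top C e^{At}B\big)\,dt$. When $A$ is Hurwitz this equals $\mathrm{Tr}(B^\top XB)$ with $X$ the observability Gramian, $XA+A^\top X+C^\top C=0$. Interpretation: the system is the linearized swing dynamics of a power network (with $\varphi=E^\top\theta$, $\theta$ the phase angles, $\omega$ the frequency deviations) in closed loop with the central averaging (broadcast) controller $\tau_\mu\dot\mu=\sum_j r_j\omega_j$, $p=-\mu K^{-1}\mathbf 1_n$, and the output satisfies $\|y\|_2^2=p^\top Kp$. *)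

theory Defs
  imports
    "HOL-Analysis.Lebesgue_Measure"
    "HOL-Analysis.Set_Integral"
    "Jordan_Normal_Form.Matrix"
begin

section \<open>Trees and weighted incidence matrices\<close>

text \<open>Simple undirected graphs on the nodes \<open>{..<n}\<close>; an edge is a two-element set of nodes.\<close>

definition simple_graph :: "nat \<Rightarrow> nat set set \<Rightarrow> bool" where
  "simple_graph n \<E> \<longleftrightarrow> (\<forall>e\<in>\<E>. \<exists>i j. e = {i, j} \<and> i < n \<and> j < n \<and> i \<noteq> j)"

definition graph_connected :: "nat \<Rightarrow> nat set set \<Rightarrow> bool" where
  "graph_connected n \<E> \<longleftrightarrow> (\<forall>u<n. \<forall>v<n. (u, v) \<in> {(i, j). {i, j} \<in> \<E>}\<^sup>*)"

definition graph_cycle :: "nat set set \<Rightarrow> nat list \<Rightarrow> bool" where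
  "graph_cycle \<E> p \<longleftrightarrow> 3 \<le> length p \<and> distinct p \<and>
     (\<forall>l. Suc l < length p \<longrightarrow> {p ! l, p ! Suc l} \<in> \<E>) \<and> {last p, hd p} \<in> \<E>"

definition graph_acyclic :: "nat set set \<Rightarrow> bool" where
  "graph_acyclic \<E> \<longleftrightarrow> (\<nexists>p. graph_cycle \<E> p)"

text \<open>An enumeration of the edges, each listed exactly once, with a choice of orientation.\<close>

definition edge_orientation :: "nat set set \<Rightarrow> (nat \<times> nat) list \<Rightarrow> bool" where
  "edge_orientation \<E> es \<longleftrightarrow> distinct es \<and> bij_betw (\<lambda>(i, j). {i, j}) (set es) \<E>"

definition incidence_matrix :: "nat \<Rightarrow> (nat set \<Rightarrow> real) \<Rightarrow> (nat \<times> nat) list \<Rightarrow> real mat" where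
  "incidence_matrix n b es =
     mat_of_cols n (map (\<lambda>(i, j). sqrt (b {i, j}) \<cdot>\<^sub>v (unit_vec n i - unit_vec n j)) es)"


section \<open>The squared \<open>H\<^sub>2\<close> norm\<close>

definition mat_exp :: "real mat \<Rightarrow> real mat" where
  "mat_exp A = mat (dim_row A) (dim_row A) (\<lambda>(i, j). \<Sum>p. (A ^\<^sub>m p) $$ (i, j) / fact p)"

definition mat_trace :: "real mat \<Rightarrow> real" where
  "mat_trace A = (\<Sum>i<dim_row A. A $$ (i, i))"

text \<open>For the system \<open>x' = A x + B \<eta>\<close>, \<open>y = C x\<close>. The integrand is nonnegative, being the trace
  of a Gram matrix; the value is \<open>\<infinity>\<close> if the integral diverges.\<close>

definition h2_norm_sq :: "real mat \<Rightarrow> real mat \<Rightarrow> real mat \<Rightarrow> ennreal" where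
  "h2_norm_sq A B C = (\<integral>\<^sup>+t\<in>{0..}.
     ennreal (mat_trace (B\<^sup>T * mat_exp (t \<cdot>\<^sub>m A\<^sup>T) * C\<^sup>T * C * mat_exp (t \<cdot>\<^sub>m A) * B)) \<partial>lborel)"


section \<open>Swing dynamics with central averaging control\<close>

text \<open>The matrices \<open>M\<close>, \<open>D\<close>, \<open>K\<close>, \<open>R\<close> and \<open>B\<^sub>1\<close> are diagonal and are passed as the functions
  giving their diagonals, so that \<open>M\<^sup>-\<^sup>1\<close>, \<open>K\<^sup>-\<^sup>1\<close> and \<open>K\<^sup>-\<^sup>1\<^sup>/\<^sup>2\<close> are formed entrywise. The state is
  ordered as \<open>(\<phi>, \<omega>, \<mu>)\<close>, where \<open>\<phi>\<close> has one component for each column of \<open>E\<close>.\<close>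

definition ones :: "nat \<Rightarrow> real mat" where
  "ones n = mat n 1 (\<lambda>_. 1)"

definition averaging_A ::
  "nat \<Rightarrow> real mat \<Rightarrow> (nat \<Rightarrow> real) \<Rightarrow> (nat \<Rightarrow> real) \<Rightarrow> (nat \<Rightarrow> real) \<Rightarrow> (nat \<Rightarrow> real) \<Rightarrow> real \<Rightarrow> real mat" where
  "averaging_A n E m d k r \<tau> =
     (let q = dim_col E;
          Minv = mat_diag n (\<lambda>i. 1 / m i);
          Kinv = mat_diag n (\<lambda>i. 1 / k i)
      in four_block_mat
           (four_block_mat
              (0\<^sub>m q q)       (E\<^sup>T)
              (- (Minv * E))  (- (Minv * mat_diag n d)))
           (0\<^sub>m q 1 @\<^sub>r (- (Minv * Kinv * ones n)))
           (four_block_mat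
              (0\<^sub>m 1 q)       ((1 / \<tau>) \<cdot>\<^sub>m ((ones n)\<^sup>T * mat_diag n r))
              (0\<^sub>m 0 q)       (0\<^sub>m 0 n))
           (0\<^sub>m 1 1))"

definition averaging_B :: "nat \<Rightarrow> real mat \<Rightarrow> (nat \<Rightarrow> real) \<Rightarrow> (nat \<Rightarrow> real) \<Rightarrow> real mat" where
  "averaging_B n E m b\<^sub>1 =
     (let q = dim_col E;
          Minv = mat_diag n (\<lambda>i. 1 / m i)
      in (0\<^sub>m q n @\<^sub>r (Minv * mat_diag n b\<^sub>1)) @\<^sub>r 0\<^sub>m 1 n)"

definition averaging_C :: "nat \<Rightarrow> real mat \<Rightarrow> (nat \<Rightarrow> real) \<Rightarrow> real mat" where
  "averaging_C n E k =
     (let q = dim_col E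
      in four_block_mat
           (0\<^sub>m n (q + n))  (- (mat_diag n (\<lambda>i. 1 / sqrt (k i)) * ones n))
           (0\<^sub>m 0 (q + n))  (0\<^sub>m 0 1))"

text \<open>These matrices realise the descriptor-form equations of the closed loop.\<close>

definition state :: "real vec \<Rightarrow> real vec \<Rightarrow> real \<Rightarrow> real vec" where
  "state \<phi> \<omega> \<mu> = (\<phi> @\<^sub>v \<omega>) @\<^sub>v Matrix.vec 1 (\<lambda>_. \<mu>)"

lemma averaging_system_equations:
  fixes E :: "real mat" and \<phi> \<omega> \<eta> :: "real vec" and \<mu> \<tau> :: real and n q :: nat
  assumes E: "E \<in> carrier_mat n q"
    and \<phi>: "\<phi> \<in> carrier_vec q" and \<omega>: "\<omega> \<in> carrier_vec n" and \<eta>: "\<eta> \<in> carrier_vec n"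
    and m: "\<And>i. i < n \<Longrightarrow> m i > 0" and \<tau>: "\<tau> > 0"
  obtains \<phi>' \<omega>' \<mu>' where
    "averaging_A n E m d k r \<tau> *\<^sub>v state \<phi> \<omega> \<mu> + averaging_B n E m b\<^sub>1 *\<^sub>v \<eta> = state \<phi>' \<omega>' \<mu>'"
    "\<phi>' = E\<^sup>T *\<^sub>v \<omega>"
    "mat_diag n m *\<^sub>v \<omega>' = - (E *\<^sub>v \<phi>) - mat_diag n d *\<^sub>v \<omega>
       - \<mu> \<cdot>\<^sub>v (mat_diag n (\<lambda>i. 1 / k i) *\<^sub>v Matrix.vec n (\<lambda>_. 1)) + mat_diag n b\<^sub>1 *\<^sub>v \<eta>"
    "\<tau> * \<mu>' = Matrix.vec n (\<lambda>_. 1) \<bullet> (mat_diag n r *\<^sub>v \<omega>)"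
    "averaging_C n E k *\<^sub>v state \<phi> \<omega> \<mu> =
       - (\<mu> \<cdot>\<^sub>v (mat_diag n (\<lambda>i. 1 / sqrt (k i)) *\<^sub>v Matrix.vec n (\<lambda>_. 1)))"
proof -
  define u where "u = Matrix.vec n (\<lambda>_. 1 :: real)"
  define c where "c = Matrix.vec 1 (\<lambda>_. \<mu>)"
  define Minv where "Minv = mat_diag n (\<lambda>i. 1 / m i)"
  define Kinv where "Kinv = mat_diag n (\<lambda>i. 1 / k i)"
  define \<omega>' where "\<omega>' = (- (Minv * E) *\<^sub>v \<phi> + - (Minv * mat_diag n d) *\<^sub>v \<omega>)
      + - (Minv * Kinv * ones n) *\<^sub>v c + (Minv * mat_diag n b\<^sub>1) *\<^sub>v \<eta>"
  define \<mu>' where "\<mu>' = (1 / \<tau>) * (u \<bullet> (mat_diag n r *\<^sub>v \<omega>))"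
  have q: "dim_col E = q" using E by simp
  have c: "c \<in> carrier_vec 1" by (simp add: c_def)
  have u: "u \<in> carrier_vec n" by (simp add: u_def)
  have ones: "ones n \<in> carrier_mat n 1" by (simp add: ones_def)
  have Minv: "Minv \<in> carrier_mat n n" and Kinv: "Kinv \<in> carrier_mat n n"
    by (simp_all add: Minv_def Kinv_def)
  have ones_c: "ones n *\<^sub>v c = \<mu> \<cdot>\<^sub>v u"
    by (rule eq_vecI) (auto simp: ones_def c_def u_def scalar_prod_def)
  have Et: "E\<^sup>T \<in> carrier_mat q n" using E by simp
  have zero_mult: "0\<^sub>m a b *\<^sub>v v = 0\<^sub>v a" if "v \<in> carrier_vec b" for a b and v :: "real vec"
    using that by (intro eq_vecI) (auto simp: scalar_prod_def)
  have uminus_mult: "- X *\<^sub>v v = - (X *\<^sub>v v)"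
    if "X \<in> carrier_mat a b" "v \<in> carrier_vec b" for a b and v :: "real vec" and X
    using that by (intro eq_vecI) (auto simp: scalar_prod_def sum_negf)
  have smult_mult: "(x \<cdot>\<^sub>m X) *\<^sub>v v = x \<cdot>\<^sub>v (X *\<^sub>v v)"
    if "X \<in> carrier_mat a b" "v \<in> carrier_vec b" for a b x and v :: "real vec" and X
    using that by (intro eq_vecI) (auto simp: scalar_prod_def sum_distrib_left mult.assoc)
  have diag_mult: "mat_diag n f *\<^sub>v v = Matrix.vec n (\<lambda>i. f i * v $ i)"
    if v: "v \<in> carrier_vec n" for f and v :: "real vec"
  proof (rule eq_vecI)
    fix i assume i: "i < dim_vec (Matrix.vec n (\<lambda>i. f i * v $ i))"
    have "(mat_diag n f *\<^sub>v v) $ i = (\<Sum>j\<in>{0..<n}. (if i = j then f j else 0) * v $ j)"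
      using i v by (auto simp: mat_diag_def scalar_prod_def)
    also have "\<dots> = (\<Sum>j\<in>{0..<n}. if i = j then f j * v $ j else 0)"
      by (rule sum.cong) auto
    finally show "(mat_diag n f *\<^sub>v v) $ i = Matrix.vec n (\<lambda>i. f i * v $ i) $ i"
      using i by simp
  qed (simp add: mat_diag_def)
  have Av: "averaging_A n E m d k r \<tau> *\<^sub>v state \<phi> \<omega> \<mu> =
      (((0\<^sub>m q q *\<^sub>v \<phi> + E\<^sup>T *\<^sub>v \<omega>) @\<^sub>v (- (Minv * E) *\<^sub>v \<phi> + - (Minv * mat_diag n d) *\<^sub>v \<omega>))
        + ((0\<^sub>m q 1 *\<^sub>v c) @\<^sub>v (- (Minv * Kinv * ones n) *\<^sub>v c)))
      @\<^sub>v (((0\<^sub>m 1 q *\<^sub>v \<phi> + ((1 / \<tau>) \<cdot>\<^sub>m ((ones n)\<^sup>T * mat_diag n r)) *\<^sub>v \<omega>)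
          @\<^sub>v (0\<^sub>m 0 q *\<^sub>v \<phi> + 0\<^sub>m 0 n *\<^sub>v \<omega>)) + 0\<^sub>m 1 1 *\<^sub>v c)"
    unfolding averaging_A_def Let_def q state_def Minv_def[symmetric] Kinv_def[symmetric] c_def[symmetric]
    by (subst four_block_mat_mult_vec[of _ "q + n" "q + n" _ 1 _ 1],
        (use E Minv Kinv ones \<phi> \<omega> c in \<open>auto\<close>)[6],
        subst four_block_mat_mult_vec[of _ q q _ n _ n],
        (use E Minv Kinv ones \<phi> \<omega> c in \<open>auto\<close>)[6],
        subst four_block_mat_mult_vec[of _ 1 q _ n _ 0],
        (use E Minv Kinv ones \<phi> \<omega> c in \<open>auto\<close>)[6],
        subst mat_mult_append[of _ q 1 _ n],
        (use E Minv Kinv ones \<phi> \<omega> c in \<open>auto\<close>)[3]) simp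
  have Bv: "averaging_B n E m b\<^sub>1 *\<^sub>v \<eta> =
      ((0\<^sub>m q n *\<^sub>v \<eta>) @\<^sub>v ((Minv * mat_diag n b\<^sub>1) *\<^sub>v \<eta>)) @\<^sub>v (0\<^sub>m 1 n *\<^sub>v \<eta>)"
    unfolding averaging_B_def Let_def q Minv_def[symmetric]
    by (subst mat_mult_append[of _ "q + n" n _ 1], (use Minv \<eta> in \<open>auto\<close>)[3],
        subst mat_mult_append[of _ q n _ n], (use Minv \<eta> in \<open>auto\<close>)[3]) simp
  have mu: "((1 / \<tau>) \<cdot>\<^sub>m ((ones n)\<^sup>T * mat_diag n r)) *\<^sub>v \<omega> = Matrix.vec 1 (\<lambda>_. \<mu>')"
  proof -
    have "((1 / \<tau>) \<cdot>\<^sub>m ((ones n)\<^sup>T * mat_diag n r)) *\<^sub>v \<omega>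
        = (1 / \<tau>) \<cdot>\<^sub>v ((ones n)\<^sup>T *\<^sub>v (mat_diag n r *\<^sub>v \<omega>))"
      using \<omega> ones assoc_mult_mat_vec[of "(ones n)\<^sup>T" 1 n "mat_diag n r" n \<omega>]
      by (subst smult_mult[of _ 1 n]) auto
    also have "\<dots> = Matrix.vec 1 (\<lambda>_. \<mu>')"
      unfolding diag_mult[OF \<omega>] \<mu>'_def
      by (rule eq_vecI) (auto simp: ones_def u_def scalar_prod_def)
    finally show ?thesis .
  qed
  have \<omega>': "\<omega>' \<in> carrier_vec n"
    unfolding \<omega>'_def using E Minv Kinv ones
    by (intro add_carrier_vec mult_mat_vec_carrier[of _ n q] mult_mat_vec_carrier[of _ n n]
        mult_mat_vec_carrier[of _ n 1] \<phi> \<omega> \<eta> c) (auto intro: \<phi> \<omega> \<eta> c)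
  have eq1: "averaging_A n E m d k r \<tau> *\<^sub>v state \<phi> \<omega> \<mu> + averaging_B n E m b\<^sub>1 *\<^sub>v \<eta>
      = state (E\<^sup>T *\<^sub>v \<omega>) \<omega>' \<mu>'"
  proof -
    define v1 where "v1 = - (Minv * E) *\<^sub>v \<phi> + - (Minv * mat_diag n d) *\<^sub>v \<omega>"
    define v2 where "v2 = - (Minv * Kinv * ones n) *\<^sub>v c"
    define v3 where "v3 = (Minv * mat_diag n b\<^sub>1) *\<^sub>v \<eta>"
    define v0 where "v0 = E\<^sup>T *\<^sub>v \<omega>"
    have dims: "dim_vec v0 = q" "dim_vec v1 = n" "dim_vec v2 = n" "dim_vec v3 = n"
      using E Minv by (simp_all add: v0_def v1_def v2_def v3_def mat_diag_def)
    show ?thesis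
      unfolding Av Bv mu zero_mult[OF \<phi>] zero_mult[OF \<omega>] zero_mult[OF c] zero_mult[OF \<eta>]
        \<omega>'_def v0_def[symmetric] v1_def[symmetric] v2_def[symmetric] v3_def[symmetric]
      unfolding state_def by (intro eq_vecI) (auto simp: dims)
  qed
  have "\<omega>' = - (Minv *\<^sub>v (E *\<^sub>v \<phi>)) - Minv *\<^sub>v (mat_diag n d *\<^sub>v \<omega>)
      - Minv *\<^sub>v (Kinv *\<^sub>v (\<mu> \<cdot>\<^sub>v u)) + Minv *\<^sub>v (mat_diag n b\<^sub>1 *\<^sub>v \<eta>)"
  proof -
    have 1: "- (Minv * E) *\<^sub>v \<phi> = - (Minv *\<^sub>v (E *\<^sub>v \<phi>))"
      using E Minv \<phi> by (subst uminus_mult[of _ n q]) (auto simp: assoc_mult_mat_vec[of _ n n _ q])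
    have 2: "- (Minv * mat_diag n d) *\<^sub>v \<omega> = - (Minv *\<^sub>v (mat_diag n d *\<^sub>v \<omega>))"
      using Minv \<omega> by (subst uminus_mult[of _ n n]) (auto simp: assoc_mult_mat_vec[of _ n n _ n])
    have 3: "- (Minv * Kinv * ones n) *\<^sub>v c = - (Minv *\<^sub>v (Kinv *\<^sub>v (\<mu> \<cdot>\<^sub>v u)))"
      using Minv Kinv ones c
      by (subst uminus_mult[of _ n 1])
        (auto simp: assoc_mult_mat_vec[of _ n n _ 1] assoc_mult_mat_vec[of _ n n _ n] ones_c u)
    have 4: "(Minv * mat_diag n b\<^sub>1) *\<^sub>v \<eta> = Minv *\<^sub>v (mat_diag n b\<^sub>1 *\<^sub>v \<eta>)"
      using Minv \<eta> by (auto simp: assoc_mult_mat_vec[of _ n n _ n])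
    show ?thesis
      unfolding \<omega>'_def 1 2 3 4 using E Minv Kinv u \<eta> \<omega> \<phi> by (intro eq_vecI) auto
  qed
  then have \<omega>'_entries: "\<omega>' = Matrix.vec n (\<lambda>i. 1 / m i *
      (- (E *\<^sub>v \<phi>) $ i - d i * \<omega> $ i - \<mu> * (1 / k i) + b\<^sub>1 i * \<eta> $ i))"
    using E \<phi> \<omega> \<eta> u unfolding Minv_def Kinv_def
    by (simp add: diag_mult u_def) (rule eq_vecI, auto simp: algebra_simps diff_divide_distrib add_divide_distrib)
  have eq2: "mat_diag n m *\<^sub>v \<omega>' = - (E *\<^sub>v \<phi>) - mat_diag n d *\<^sub>v \<omega>
       - \<mu> \<cdot>\<^sub>v (Kinv *\<^sub>v u) + mat_diag n b\<^sub>1 *\<^sub>v \<eta>"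
    unfolding diag_mult[OF \<omega>'] diag_mult[OF \<omega>] diag_mult[OF \<eta>] Kinv_def diag_mult[OF u]
    using m E by (intro eq_vecI) (auto simp: \<omega>'_entries u_def less_imp_neq[symmetric])
  have eq4: "averaging_C n E k *\<^sub>v state \<phi> \<omega> \<mu> = - (\<mu> \<cdot>\<^sub>v (mat_diag n (\<lambda>i. 1 / sqrt (k i)) *\<^sub>v u))"
  proof -
    let ?S = "mat_diag n (\<lambda>i. 1 / sqrt (k i))"
    have S: "?S * ones n \<in> carrier_mat n 1"
      using ones by (intro mult_carrier_mat[of _ n n]) auto
    have \<phi>\<omega>: "\<phi> @\<^sub>v \<omega> \<in> carrier_vec (q + n)" using \<phi> \<omega> by simp
    have "averaging_C n E k *\<^sub>v state \<phi> \<omega> \<mu>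
        = (0\<^sub>m n (q + n) *\<^sub>v (\<phi> @\<^sub>v \<omega>) + - (?S * ones n) *\<^sub>v c)
          @\<^sub>v (0\<^sub>m 0 (q + n) *\<^sub>v (\<phi> @\<^sub>v \<omega>) + 0\<^sub>m 0 1 *\<^sub>v c)"
      unfolding averaging_C_def Let_def q state_def c_def[symmetric]
      by (rule four_block_mat_mult_vec[of _ n "q + n" _ 1 _ 0]) (use \<phi>\<omega> c S in auto)
    also have "- (?S * ones n) *\<^sub>v c = - (?S *\<^sub>v (\<mu> \<cdot>\<^sub>v u))"
      using ones c S
      by (subst uminus_mult[of _ n 1]) (auto simp: assoc_mult_mat_vec[of _ n n _ 1] ones_c)
    finally show ?thesis
      unfolding zero_mult[OF \<phi>\<omega>] zero_mult[OF c] using u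
      by (intro eq_vecI) (auto simp: diag_mult)
  qed
  show thesis
    using that[OF eq1 refl eq2[unfolded Kinv_def u_def] _ eq4[unfolded u_def]] \<tau>
    by (simp add: \<mu>'_def u_def)
qed

end

theory Submission
  imports Defs "HOL-Analysis.Equivalence_Lebesgue_Henstock_Integration"
begin

text \<open>Since \<open>1\<^sup>T E = 0\<close>, the output only sees \<open>\<mu>\<close> and \<open>s = 1\<^sup>T \<omega>\<close>, which decouple from \<open>\<phi>\<close>:
  \<open>m s' = - d s - (n / k) \<mu> + b 1\<^sup>T \<eta>\<close> and \<open>\<tau> \<mu>' = s / n\<close>. In terms of the matrix exponential, its
  \<open>\<mu>\<close>-row is a combination \<open>F(t) e\<^sub>\<mu>\<^sup>T + H(t) 1\<^sub>\<omega>\<^sup>T\<close>, where \<open>F, H\<close>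
  solve a damped oscillator equation. The integrand is a multiple of \<open>H\<^sup>2\<close>, which a quadratic
  Lyapunov function integrates exactly.\<close>

section \<open>Exponential-type power series and the energy of a damped oscillator\<close>

text \<open>Domination by the exponential series in \<open>K * \<bar>y\<bar>\<close> gives
  convergence everywhere, and the factorial absorbs the factor \<open>Suc p\<close> of termwise
  differentiation, so differentiating merely shifts the coefficients. A linear recursion for
  \<open>a\<close> thus becomes a linear differential equation.\<close>

lemma power_series_fact_has_derivative:
  fixes a :: "nat \<Rightarrow> real"
  assumes "\<And>p. \<bar>a p\<bar> \<le> K ^ p"
  shows "((\<lambda>t. \<Sum>p. t ^ p * a p / fact p) has_real_derivative (\<Sum>p. t ^ p * a (Suc p) / fact p)) (at t)"
proof -
  have K: "0 \<le> K" using assms[of 1] by simp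
  have "summable (\<lambda>p. a p / fact p * y ^ p)" for y
  proof (rule summable_comparison_test')
    show "summable (\<lambda>p. inverse (fact p) * (K * \<bar>y\<bar>) ^ p)" by (rule summable_exp)
    show "norm (a p / fact p * y ^ p) \<le> inverse (fact p) * (K * \<bar>y\<bar>) ^ p" for p
      using mult_right_mono[OF assms[of p], of "\<bar>y\<bar> ^ p"] K
      by (simp add: abs_mult power_abs power_mult_distrib divide_simps)
  qed
  then have "((\<lambda>t. \<Sum>p. a p / fact p * t ^ p) has_real_derivative
      (\<Sum>p. diffs (\<lambda>p. a p / fact p) p * t ^ p)) (at t)"
    by (rule termdiffs_strong_converges_everywhere)
  moreover have "diffs (\<lambda>p. a p / fact p) p = a (Suc p) / fact p" for p
    by (simp add: diffs_def del: of_nat_Suc)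
  ultimately show ?thesis by (simp add: mult.commute)
qed

lemma summable_power_series_fact:
  fixes a :: "nat \<Rightarrow> real"
  assumes "\<And>p. \<bar>a p\<bar> \<le> K ^ p"
  shows "summable (\<lambda>p. t ^ p * a p / fact p)"
proof (rule summable_comparison_test')
  have K: "0 \<le> K" using assms[of 1] by simp
  show "summable (\<lambda>p. inverse (fact p) * (K * \<bar>t\<bar>) ^ p)" by (rule summable_exp)
  show "norm (t ^ p * a p / fact p) \<le> inverse (fact p) * (K * \<bar>t\<bar>) ^ p" for p
    using mult_right_mono[OF assms[of p], of "\<bar>t\<bar> ^ p"] K
    by (simp add: abs_mult power_abs power_mult_distrib divide_simps mult.commute)
qed

lemma damped_oscillator_energy:
  fixes F H :: "real \<Rightarrow> real"
  assumes pos: "0 < \<alpha>" "0 < \<gamma>" "0 < \<delta>"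
    and F: "\<And>t. (F has_real_derivative - \<gamma> * H t) (at t)"
    and H: "\<And>t. (H has_real_derivative \<delta> * F t - \<alpha> * H t) (at t)"
    and init: "F 0 = 1" "H 0 = 0"
  shows "(\<integral>\<^sup>+t\<in>{0..}. ennreal ((H t)\<^sup>2) \<partial>lborel) = ennreal (\<delta> / (2 * \<alpha> * \<gamma>))"
proof -
  \<comment> \<open>The Lyapunov functions solving \<open>V' = - H\<^sup>2\<close> and \<open>U' = - 2 \<alpha> \<gamma> V\<close>. Since \<open>V\<close> decreases,
    \<open>U + 2 \<alpha> \<gamma> t V\<close> decreases too, so that \<open>V = O(1/t)\<close> and no eigenvalues are needed.\<close>
  define V where "V t = \<delta> / (2 * \<alpha> * \<gamma>) * (F t)\<^sup>2 + 1 / (2 * \<alpha>) * (H t)\<^sup>2" for t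
  define U where "U t = \<delta> / \<alpha> * (F t)\<^sup>2 + 1 / (2 * \<alpha> * \<gamma>) * (\<alpha> * F t - \<gamma> * H t)\<^sup>2
      + \<gamma> / (2 * \<alpha>) * (H t)\<^sup>2" for t
  have V: "(V has_real_derivative - (H t)\<^sup>2) (at t)" for t
    unfolding V_def
    by (rule derivative_eq_intros F H refl)+ (use pos in \<open>simp_all add: field_simps power2_eq_square\<close>)
  \<comment> \<open>The damping terms cancel in the derivative of
    \<open>\<alpha> * F t - \<gamma> * H t\<close>, which is
    \<open>- \<gamma> * \<delta> * F t\<close>. Its square therefore yields -\<delta> F^2, the last
    square yields -\<gamma> H^2, and the mixed terms F H of the three squares add up to
    zero.\<close>
  have U: "(U has_real_derivative - (2 * \<alpha> * \<gamma>) * V t) (at t)" for t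
    unfolding U_def
    by (rule derivative_eq_intros F H refl)+
      (use pos in \<open>simp_all add: V_def field_simps power2_eq_square\<close>)
  have V_nonneg: "0 \<le> V t" and U_nonneg: "0 \<le> U t" for t
    using pos by (simp_all add: V_def U_def)
  have UV: "U t + 2 * \<alpha> * \<gamma> * t * V t \<le> U 0" if "0 \<le> t" for t
  proof -
    have "U t + 2 * \<alpha> * \<gamma> * t * V t \<le> U 0 + 2 * \<alpha> * \<gamma> * 0 * V 0"
    proof (rule DERIV_nonpos_imp_nonincreasing[OF that])
      fix s :: real assume "0 \<le> s"
      moreover have "((\<lambda>s. U s + 2 * \<alpha> * \<gamma> * s * V s) has_real_derivative
          - (2 * \<alpha> * \<gamma> * s * (H s)\<^sup>2)) (at s)"
        by (rule derivative_eq_intros U V refl | simp)+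
      ultimately show "\<exists>y. ((\<lambda>s. U s + 2 * \<alpha> * \<gamma> * s * V s) has_real_derivative y) (at s) \<and> y \<le> 0"
        using pos by (intro exI conjI) auto
    qed
    then show ?thesis by simp
  qed
  have "(V \<longlongrightarrow> 0) at_top"
  proof (rule tendsto_sandwich)
    show "\<forall>\<^sub>F t in at_top. 0 \<le> V t" using V_nonneg by simp
    show "\<forall>\<^sub>F t in at_top. V t \<le> U 0 / (2 * \<alpha> * \<gamma>) / t"
      using eventually_gt_at_top[of 0]
    proof eventually_elim
      case (elim t)
      then have "2 * \<alpha> * \<gamma> * t * V t \<le> U 0" using UV[of t] U_nonneg[of t] by simp
      then show ?case using elim pos by (simp add: field_simps)
    qed
    show "((\<lambda>t. U 0 / (2 * \<alpha> * \<gamma>) / t) \<longlongrightarrow> 0) at_top"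
      by (rule tendsto_divide_0[OF tendsto_const filterlim_at_top_imp_at_infinity]) (rule filterlim_ident)
  qed simp
  then have lim: "((\<lambda>t. - V t) \<longlongrightarrow> 0) at_top" using tendsto_minus by fastforce
  have "isCont H t" for t using H DERIV_isCont by blast
  then have "continuous_on UNIV H" by (simp add: continuous_at_imp_continuous_on)
  then have "H \<in> borel_measurable borel" by (rule borel_measurable_continuous_onI)
  then have "(\<lambda>t. (H t)\<^sup>2) \<in> borel_measurable borel" by measurable
  \<comment> \<open>\<open>- V\<close> is an antiderivative of H^2 that vanishes at infinity, so the
    integral is \<open>V 0\<close>; by \<open>init\<close> this is the coefficient of F^2 in
    \<open>V\<close>.\<close>
  from nn_integral_FTC_atLeast[OF this _ _ lim, of 0] V
  have "(\<integral>\<^sup>+t\<in>{0..}. ennreal ((H t)\<^sup>2) \<partial>lborel) = 0 - ( - V 0)"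
    using DERIV_minus[OF V] by simp
  then show ?thesis using init by (simp add: V_def)
qed

section \<open>Powers, exponentials and transposes of matrices\<close>

lemma smult_pow_mat:
  fixes A :: "'a :: comm_semiring_1 mat"
  assumes A: "A \<in> carrier_mat n n"
  shows "(t \<cdot>\<^sub>m A) ^\<^sub>m p = t ^ p \<cdot>\<^sub>m (A ^\<^sub>m p)"
proof (induction p)
  case 0
  then show ?case using A by (intro eq_matI) auto
next
  case (Suc p)
  have "A ^\<^sub>m p \<in> carrier_mat n n" using A by simp
  then show ?case using A Suc by (intro eq_matI) (auto simp: mult_ac)
qed

lemma transpose_pow_mat:
  fixes A :: "'a :: comm_semiring_1 mat"
  assumes A: "A \<in> carrier_mat n n"
  shows "(A ^\<^sub>m p)\<^sup>T = A\<^sup>T ^\<^sub>m p"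
proof (induction p)
  case 0
  then show ?case using A by simp
next
  case (Suc p)
  have P: "A ^\<^sub>m p \<in> carrier_mat n n" using A by simp
  have "A\<^sup>T ^\<^sub>m Suc p = (A ^\<^sub>m p)\<^sup>T * A\<^sup>T" using Suc by simp
  also have "\<dots> = (A * A ^\<^sub>m p)\<^sup>T" by (rule transpose_mult[OF A P, symmetric])
  \<comment> \<open>Transposition reverses the factors while \<open>^\<^sub>m\<close> appends the
    new factor on the right, so \<open>A\<close> has to be moved past its own power.\<close>
  also have "A * A ^\<^sub>m p = A ^\<^sub>m Suc p"
  proof (induction p)
    case 0
    then show ?case using A by simp
  next
    case (Suc p)
    then show ?case using A
      by (metis assoc_mult_mat pow_carrier_mat pow_mat.simps(2))
  qed
  finally show ?case ..
qed

text \<open>Transposition commutes with every power, hence with the entrywise series. The two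
  exponentials in \<open>h2_norm_sq\<close> become transposes of each other, which turns the
  integrand into the trace of a Gram matrix.\<close>

lemma mat_exp_transpose:
  assumes A: "A \<in> carrier_mat n n"
  shows "mat_exp (t \<cdot>\<^sub>m A\<^sup>T) = (mat_exp (t \<cdot>\<^sub>m A))\<^sup>T"
proof -
  have "(t \<cdot>\<^sub>m A\<^sup>T) = (t \<cdot>\<^sub>m A)\<^sup>T" by (rule eq_matI) auto
  moreover have tA: "t \<cdot>\<^sub>m A \<in> carrier_mat n n" using A by simp
  moreover have "((t \<cdot>\<^sub>m A)\<^sup>T ^\<^sub>m p) $$ (i, j) = ((t \<cdot>\<^sub>m A) ^\<^sub>m p) $$ (j, i)"
    if "i < n" "j < n" for i j p
    using that pow_carrier_mat[OF tA, of p] unfolding transpose_pow_mat[OF tA, symmetric]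
    by (metis carrier_matD index_transpose_mat(1))
  ultimately show ?thesis using A by (intro eq_matI) (auto simp: mat_exp_def)
qed

lemma mat_exp_smult_index:
  assumes A: "A \<in> carrier_mat n n" and "i < n" "j < n"
  shows "mat_exp (t \<cdot>\<^sub>m A) $$ (i, j) = (\<Sum>p. t ^ p * (A ^\<^sub>m p) $$ (i, j) / fact p)"
  using assms pow_carrier_mat[OF A] by (simp add: mat_exp_def smult_pow_mat[OF A])

lemma mat_trace_gram:
  "mat_trace (X\<^sup>T * X) = (\<Sum>j<dim_col X. \<Sum>i<dim_row X. (X $$ (i, j))\<^sup>2)"
  by (auto simp: mat_trace_def scalar_prod_def power2_eq_square lessThan_atLeast0 intro!: sum.cong)

section \<open>The \<open>\<mu>\<close>-row of the powers of the system matrix\<close>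

text \<open>Each column is a multiple of a difference of two unit vectors with indices below
  \<open>n\<close>, so its entries cancel. This is the identity 1^T E = 0 that removes
  \<open>\<phi>\<close> from the equation of the summed frequency.\<close>

lemma incidence_matrix_col_sum:
  assumes "simple_graph n \<E>" and "edge_orientation \<E> es" and "j < length es"
  shows "(\<Sum>i<n. incidence_matrix n w es $$ (i, j)) = 0"
proof -
  obtain u v where uv: "es ! j = (u, v)" by (cases "es ! j")
  then have "{u, v} \<in> \<E>"
    using assms nth_mem[of j es] unfolding edge_orientation_def bij_betw_def by fastforce
  then obtain u' v' where "{u, v} = {u', v'}" "u' < n" "v' < n"
    using assms(1) unfolding simple_graph_def by blast
  then have "u < n" "v < n" by (auto simp: doubleton_eq_iff)
  have "(\<Sum>i<n. incidence_matrix n w es $$ (i, j))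
      = (\<Sum>i<n. sqrt (w {u, v}) * ((if i = u then 1 else 0) - (if i = v then 1 else 0)))"
    using uv assms(3) \<open>u < n\<close> \<open>v < n\<close>
    by (intro sum.cong refl) (auto simp: incidence_matrix_def mat_of_cols_index unit_vec_def)
  also have "\<dots> = 0"
    using \<open>u < n\<close> \<open>v < n\<close> by (simp add: sum_subtractf flip: sum_distrib_left)
  finally show ?thesis .
qed

text \<open>The index range is split along the blocks \<open>\<phi>\<close>,
  \<open>\<omega>\<close>, \<open>\<mu>\<close> of the state, so that blockwise entry formulas can
  be inserted.\<close>

lemma mat_mult_row_concat:
  fixes X Y :: "real mat"
  assumes "X \<in> carrier_mat r (q + n + 1)" and "Y \<in> carrier_mat (q + n + 1) s"
    and "i < r" and "j < s"
  shows "(X * Y) $$ (i, j) = (\<Sum>l<q. X $$ (i, l) * Y $$ (l, j))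
    + (\<Sum>l<n. X $$ (i, q + l) * Y $$ (q + l, j)) + X $$ (i, q + n) * Y $$ (q + n, j)"
proof -
  have "(X * Y) $$ (i, j) = (\<Sum>l<q + n + 1. X $$ (i, l) * Y $$ (l, j))"
    using assms by (simp add: scalar_prod_def lessThan_atLeast0)
  also have "\<dots> = (\<Sum>l<q + n. X $$ (i, l) * Y $$ (l, j)) + X $$ (i, q + n) * Y $$ (q + n, j)"
    by simp
  also have "(\<Sum>l<q + n. X $$ (i, l) * Y $$ (l, j)) = (\<Sum>l<q. X $$ (i, l) * Y $$ (l, j))
      + (\<Sum>l<n. X $$ (i, q + l) * Y $$ (q + l, j))"
    by (induction n) (auto simp: add.assoc)
  finally show ?thesis .
qed

text \<open>The coefficients of \<open>e\<^sub>\<mu>\<^sup>T\<close> and \<open>1\<^sub>\<omega>\<^sup>T\<close> in the \<open>\<mu>\<close>-row of the \<open>p\<close>-th power of the system matrix.\<close>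

fun row_coeff :: "real \<Rightarrow> real \<Rightarrow> real \<Rightarrow> nat \<Rightarrow> real \<times> real" where
  "row_coeff \<alpha> \<gamma> \<delta> 0 = (1, 0)"
| "row_coeff \<alpha> \<gamma> \<delta> (Suc p) =
     (case row_coeff \<alpha> \<gamma> \<delta> p of (a, c) \<Rightarrow> (- \<gamma> * c, \<delta> * a - \<alpha> * c))"

text \<open>If both coefficients are at most \<open>K\<close> in absolute value, the next ones are
  at most \<gamma> K and (\<alpha> + \<delta>) K. Geometric growth is what the power series lemmas
  require.\<close>

lemma row_coeff_bound:
  assumes "0 < \<alpha>" "0 < \<gamma>" "0 < \<delta>"
  shows "\<bar>fst (row_coeff \<alpha> \<gamma> \<delta> p)\<bar> \<le> (\<alpha> + \<gamma> + \<delta>) ^ p \<and> \<bar>snd (row_coeff \<alpha> \<gamma> \<delta> p)\<bar> \<le> (\<alpha> + \<gamma> + \<delta>) ^ p"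
proof (induction p)
  case (Suc p)
  obtain a c where ac: "row_coeff \<alpha> \<gamma> \<delta> p = (a, c)" by fastforce
  define K where "K = (\<alpha> + \<gamma> + \<delta>) ^ p"
  have K: "\<bar>a\<bar> \<le> K" "\<bar>c\<bar> \<le> K" using Suc ac by (simp_all add: K_def)
  have *: "\<bar>\<gamma> * c\<bar> \<le> \<gamma> * K" "\<bar>\<delta> * a\<bar> \<le> \<delta> * K" "\<bar>\<alpha> * c\<bar> \<le> \<alpha> * K" "0 \<le> \<alpha> * K" "0 \<le> \<gamma> * K" "0 \<le> \<delta> * K"
    using K assms by (auto simp: abs_mult)
  have "(\<alpha> + \<gamma> + \<delta>) ^ Suc p = \<alpha> * K + \<gamma> * K + \<delta> * K" by (simp add: K_def algebra_simps)
  with * ac show ?case by auto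
qed simp

lemma averaging_A_carrier:
  assumes "E \<in> carrier_mat n q"
  shows "averaging_A n E m d k r \<tau> \<in> carrier_mat (q + n + 1) (q + n + 1)"
  using assms by (intro carrier_matI) (simp_all add: averaging_A_def Let_def append_rows_def mat_diag_def)

lemma averaging_A_index:
  fixes E :: "real mat" and m d k r :: "nat \<Rightarrow> real" and \<tau> :: real
  assumes "E \<in> carrier_mat n q" and "i < n"
  defines "A \<equiv> averaging_A n E m d k r \<tau>"
  shows "j < q \<Longrightarrow> A $$ (q + i, j) = - E $$ (i, j) / m i"
    and "j < n \<Longrightarrow> A $$ (q + i, q + j) = (if i = j then - d i / m i else 0)"
    and "A $$ (q + i, q + n) = - 1 / (m i * k i)"
    and "j < q \<Longrightarrow> A $$ (q + n, j) = 0"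
    and "j < n \<Longrightarrow> A $$ (q + n, q + j) = r j / \<tau>"
    and "A $$ (q + n, q + n) = 0"
  using assms(1,2) unfolding A_def averaging_A_def Let_def
  by (simp_all add: append_rows_def ones_def mat_diag_mult_left[of _ n q] mat_diag_mult_right[of _ 1 n]
      mat_diag_mult_left[of _ n 1] mat_diag_mult_left[of _ n n])
     (auto simp: mat_diag_def)

text \<open>Right multiplication by \<open>A\<close> sends a row (0, c 1^T, a) to (-(c/m) 1^T E, (a
  r/\<tau> - c d/m) 1^T, -c n/(m k)). The first block vanishes by \<open>E0\<close>; the others are
  one step of \<open>row_coeff\<close>.\<close>

lemma averaging_A_pow_row:
  fixes E :: "real mat" and m d k r \<tau> :: real
  assumes E: "E \<in> carrier_mat n q" and E0: "\<And>j. j < q \<Longrightarrow> (\<Sum>i<n. E $$ (i, j)) = 0" and n: "0 < n"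
  defines "A \<equiv> averaging_A n E (\<lambda>_. m) (\<lambda>_. d) (\<lambda>_. k) (\<lambda>_. r) \<tau>"
  defines "ac \<equiv> row_coeff (d / m) (real n / (m * k)) (r / \<tau>)"
  shows "(\<forall>j<q. (A ^\<^sub>m p) $$ (q + n, j) = 0) \<and> (\<forall>j<n. (A ^\<^sub>m p) $$ (q + n, q + j) = snd (ac p))
    \<and> (A ^\<^sub>m p) $$ (q + n, q + n) = fst (ac p)"
proof (induction p)
  case 0
  then show ?case using averaging_A_carrier[OF E, of "\<lambda>_. m" "\<lambda>_. d" "\<lambda>_. k" "\<lambda>_. r" \<tau>] by (simp add: A_def ac_def)
next
  case (Suc p)
  have A: "A \<in> carrier_mat (q + n + 1) (q + n + 1)" unfolding A_def by (rule averaging_A_carrier[OF E])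
  have step: "(A ^\<^sub>m Suc p) $$ (q + n, j) =
      (\<Sum>l<n. snd (ac p) * A $$ (q + l, j)) + fst (ac p) * A $$ (q + n, j)" if "j < q + n + 1" for j
    using Suc mat_mult_row_concat[OF pow_carrier_mat[OF A] A, of "q + n" j p] that by simp
  have "(A ^\<^sub>m Suc p) $$ (q + n, j) = 0" if "j < q" for j
  proof -
    have "(\<Sum>l<n. snd (ac p) * A $$ (q + l, j)) = (\<Sum>l<n. - (snd (ac p) / m) * E $$ (l, j))"
      using that by (intro sum.cong) (simp_all add: A_def averaging_A_index[OF E])
    also have "\<dots> = 0" using E0[OF that] by (simp only: sum_distrib_left[symmetric] mult_zero_right)
    finally show ?thesis using that n step[of j] by (simp add: A_def averaging_A_index[OF E])
  qed
  moreover have "(A ^\<^sub>m Suc p) $$ (q + n, q + j) = snd (ac (Suc p))" if "j < n" for j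
    using that n step[of "q + j"]
    by (simp add: A_def averaging_A_index[OF E] if_distrib cong: if_cong)
      (simp add: ac_def split_beta mult.commute)
  \<comment> \<open>All \<open>n\<close> entries -1/(m k) of the \<open>\<mu>\<close>-column are
    added here, whence the factor \<open>real n\<close> in the second parameter of
    \<open>row_coeff\<close>. In the diagonal \<open>\<omega>\<close>-block a single term
    remained.\<close>
  moreover have "(A ^\<^sub>m Suc p) $$ (q + n, q + n) = fst (ac (Suc p))"
    using n step[of "q + n"]
    by (simp add: A_def averaging_A_index[OF E]) (simp add: ac_def split_beta)
  ultimately show ?case by blast
qed

section \<open>Input and output matrices and the impulse response\<close>

lemma averaging_B_carrier:
  assumes "E \<in> carrier_mat n q"
  shows "averaging_B n E m b \<in> carrier_mat (q + n + 1) n"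
  using assms by (intro carrier_matI) (simp_all add: averaging_B_def Let_def append_rows_def mat_diag_def)

lemma averaging_B_index:
  assumes "E \<in> carrier_mat n q" and "j < n"
  shows "i < q \<Longrightarrow> averaging_B n E m b $$ (i, j) = 0"
    and "i < n \<Longrightarrow> averaging_B n E m b $$ (q + i, j) = (if i = j then b i / m i else 0)"
    and "averaging_B n E m b $$ (q + n, j) = 0"
  using assms unfolding averaging_B_def Let_def mat_diag_diag
  by (auto simp: append_rows_def) (auto simp: mat_diag_def)

lemma averaging_C_carrier:
  assumes "E \<in> carrier_mat n q"
  shows "averaging_C n E k \<in> carrier_mat n (q + n + 1)"
  using assms by (auto simp: averaging_C_def Let_def)

lemma averaging_C_index:
  assumes "E \<in> carrier_mat n q" and "i < n"
  shows "j < q + n \<Longrightarrow> averaging_C n E k $$ (i, j) = 0"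
    and "averaging_C n E k $$ (i, q + n) = - 1 / sqrt (k i)"
  using assms by (auto simp: averaging_C_def Let_def ones_def mat_diag_mult_left[of _ n 1])

text \<open>The output reads only \<open>\<mu>\<close> and the input drives only
  \<open>\<omega>\<close>, so of \<open>X\<close> only the \<open>\<omega>\<close>-entries of its
  \<open>\<mu>\<close>-row survive. With the matrix exponential for \<open>X\<close> the product is
  the impulse response.\<close>

lemma averaging_impulse_response_index:
  assumes E: "E \<in> carrier_mat n q" and X: "X \<in> carrier_mat (q + n + 1) (q + n + 1)"
    and H: "\<And>j. j < n \<Longrightarrow> X $$ (q + n, q + j) = h"
    and ij: "i < n" "j < n"
  shows "(averaging_C n E k * X * averaging_B n E m b) $$ (i, j) = - (h * b j / (sqrt (k i) * m j))"
proof -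
  note C = averaging_C_carrier[OF E, of k] and B = averaging_B_carrier[OF E, of m b]
  have CX: "(averaging_C n E k * X) $$ (i, l) = - X $$ (q + n, l) / sqrt (k i)" if "l < q + n + 1" for l
    using mat_mult_row_concat[OF C X ij(1) that] averaging_C_index[OF E ij(1)] by simp
  have "(\<Sum>l<n. (averaging_C n E k * X) $$ (i, q + l) * averaging_B n E m b $$ (q + l, j))
      = (\<Sum>l<n. if l = j then - h / sqrt (k i) * (b j / m j) else 0)"
    by (rule sum.cong) (auto simp: averaging_B_index[OF E ij(2)] CX H)
  also have "\<dots> = - (h * b j / (sqrt (k i) * m j))" using ij by simp
  finally show ?thesis
    using mat_mult_row_concat[OF mult_carrier_mat[OF C X] B ij] averaging_B_index[OF E ij(2)] by simp
qed


section \<open>Evaluation of the H2 integral\<close>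

theorem mainTheorem1:
  fixes n :: nat and \<E> :: "nat set set" and w :: "nat set \<Rightarrow> real" and es :: "(nat \<times> nat) list"
    and E :: "real mat" and m d k b \<tau> :: real
  assumes "1 \<le> n"
    and "simple_graph n \<E>"
    and "graph_connected n \<E>"
    and "graph_acyclic \<E>"
    and "\<And>e. e \<in> \<E> \<Longrightarrow> 0 < w e"
    and "edge_orientation \<E> es"
    and "E = incidence_matrix n w es"
    and "0 < m" and "0 < d" and "0 < k" and "0 < b" and "0 < \<tau>"
  shows "h2_norm_sq
           (averaging_A n E (\<lambda>_. m) (\<lambda>_. d) (\<lambda>_. k) (\<lambda>_. 1 / real n) \<tau>)
           (averaging_B n E (\<lambda>_. m) (\<lambda>_. b))
           (averaging_C n E (\<lambda>_. k))
         = ennreal (b\<^sup>2 / (2 * \<tau>) * (1 / d))"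
proof -
  define q where "q = length es"
  \<comment> \<open>For the summed frequency s, \<open>\<alpha>\<close> is its decay rate,
    \<open>\<gamma>\<close> the strength with which \<mu> brakes s, and \<open>\<delta>\<close> the
    rate at which s drives \<mu>.\<close>
  define \<alpha> where "\<alpha> = d / m"
  define \<gamma> where "\<gamma> = real n / (m * k)"
  define \<delta> where "\<delta> = 1 / real n / \<tau>"
  define ac where "ac = row_coeff \<alpha> \<gamma> \<delta>"
  \<comment> \<open>\<open>F t\<close> is the (\<mu>, \<mu>) entry of the exponential of
    \<open>t \<cdot>\<^sub>m A\<close>, and \<open>H t\<close> the entry of its \<mu>-row shared by
    all \<omega>-columns.\<close>
  define F where "F t = (\<Sum>p. t ^ p * fst (ac p) / fact p)" for t
  define H where "H t = (\<Sum>p. t ^ p * snd (ac p) / fact p)" for t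
  define A where "A = averaging_A n E (\<lambda>_. m) (\<lambda>_. d) (\<lambda>_. k) (\<lambda>_. 1 / real n) \<tau>"
  define B where "B = averaging_B n E (\<lambda>_. m) (\<lambda>_. b)"
  define C where "C = averaging_C n E (\<lambda>_. k)"
  have n: "0 < n" using assms(1) by simp
  have pos: "0 < \<alpha>" "0 < \<gamma>" "0 < \<delta>"
    using assms n by (simp_all add: \<alpha>_def \<gamma>_def \<delta>_def)
  have E: "E \<in> carrier_mat n q" by (simp add: assms(7) incidence_matrix_def q_def carrier_matI)
  have E0: "(\<Sum>i<n. E $$ (i, j)) = 0" if "j < q" for j
    using incidence_matrix_col_sum[OF assms(2,6)] that by (simp add: assms(7) q_def)
  have A: "A \<in> carrier_mat (q + n + 1) (q + n + 1)" unfolding A_def by (rule averaging_A_carrier[OF E])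
  have B: "B \<in> carrier_mat (q + n + 1) n" unfolding B_def by (rule averaging_B_carrier[OF E])
  have C: "C \<in> carrier_mat n (q + n + 1)" unfolding C_def by (rule averaging_C_carrier[OF E])
  have a_bound: "\<bar>fst (ac p)\<bar> \<le> (\<alpha> + \<gamma> + \<delta>) ^ p" and c_bound: "\<bar>snd (ac p)\<bar> \<le> (\<alpha> + \<gamma> + \<delta>) ^ p" for p
    using row_coeff_bound[OF pos] by (simp_all add: ac_def)
  have ac_Suc: "fst (ac (Suc p)) = - \<gamma> * snd (ac p)" "snd (ac (Suc p)) = \<delta> * fst (ac p) - \<alpha> * snd (ac p)" for p
    by (simp_all add: ac_def split_beta)
  note smF = summable_power_series_fact[OF a_bound] and smH = summable_power_series_fact[OF c_bound]
  have F': "(F has_real_derivative - \<gamma> * H t) (at t)" for t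
  proof -
    have "(\<Sum>p. t ^ p * fst (ac (Suc p)) / fact p) = (\<Sum>p. - \<gamma> * (t ^ p * snd (ac p) / fact p))"
      by (simp add: ac_Suc mult_ac)
    also have "\<dots> = - \<gamma> * H t" unfolding H_def by (rule suminf_mult[OF smH])
    finally show ?thesis
      using power_series_fact_has_derivative[OF a_bound, of t] by (simp add: F_def[abs_def])
  qed
  have H': "(H has_real_derivative \<delta> * F t - \<alpha> * H t) (at t)" for t
  proof -
    have "(\<Sum>p. t ^ p * snd (ac (Suc p)) / fact p)
        = (\<Sum>p. \<delta> * (t ^ p * fst (ac p) / fact p) - \<alpha> * (t ^ p * snd (ac p) / fact p))"
      by (simp add: ac_Suc algebra_simps diff_divide_distrib)
    also have "\<dots> = \<delta> * F t - \<alpha> * H t"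
      unfolding H_def F_def suminf_mult[OF smH, symmetric] suminf_mult[OF smF, symmetric]
      by (intro suminf_diff[symmetric] summable_mult smF smH)
    finally show ?thesis
      using power_series_fact_has_derivative[OF c_bound, of t] by (simp add: H_def[abs_def])
  qed
  have init: "F 0 = 1" "H 0 = 0"
    using powser_zero[of "\<lambda>p. fst (ac p) / fact p"] powser_zero[of "\<lambda>p. snd (ac p) / fact p"]
    by (simp_all add: F_def H_def ac_def mult_ac)
  have integrand: "mat_trace (B\<^sup>T * mat_exp (t \<cdot>\<^sub>m A\<^sup>T) * C\<^sup>T * C * mat_exp (t \<cdot>\<^sub>m A) * B)
      = (real n * b / m)\<^sup>2 / k * (H t)\<^sup>2" for t
  proof -
    define X where "X = mat_exp (t \<cdot>\<^sub>m A)"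
    have X: "X \<in> carrier_mat (q + n + 1) (q + n + 1)" using A by (simp add: X_def mat_exp_def)
    define Y where "Y = C * X * B"
    have Y: "Y \<in> carrier_mat n n" using B C X by (simp add: Y_def)
    have "X $$ (q + n, q + j) = H t" if "j < n" for j
      using that averaging_A_pow_row[OF E E0 n, of m d k "1 / real n" \<tau>]
      unfolding X_def by (subst mat_exp_smult_index[OF A]) (simp_all add: H_def A_def ac_def \<alpha>_def \<gamma>_def \<delta>_def)
    from averaging_impulse_response_index[OF E X this]
    have Y_idx: "(Y $$ (i, j))\<^sup>2 = (b / m)\<^sup>2 / k * (H t)\<^sup>2" if "i < n" "j < n" for i j
      using that \<open>0 < k\<close> by (simp add: Y_def B_def C_def power_mult_distrib power_divide mult.commute)
    have "Y\<^sup>T = B\<^sup>T * (X\<^sup>T * C\<^sup>T)"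
      unfolding Y_def transpose_mult[OF mult_carrier_mat[OF C X] B] transpose_mult[OF C X] ..
    \<comment> \<open>The product in \<open>h2_norm_sq\<close> is nested to the left; regrouping
      exhibits it as the Gram matrix of the impulse response \<open>Y\<close>.\<close>
    moreover have "B\<^sup>T * X\<^sup>T * C\<^sup>T * C * X * B = (B\<^sup>T * (X\<^sup>T * C\<^sup>T)) * (C * X * B)"
    proof -
      have "B\<^sup>T * X\<^sup>T * C\<^sup>T = B\<^sup>T * (X\<^sup>T * C\<^sup>T)" (is "_ = ?Z")
        using B C X by (intro assoc_mult_mat[of _ n "q + n + 1" _ "q + n + 1" _ n]) auto
      moreover have Z: "?Z \<in> carrier_mat n n" using B C X by simp
      moreover have "?Z * C * X = ?Z * (C * X)" by (rule assoc_mult_mat[OF Z C X])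
      moreover have "?Z * (C * X) * B = ?Z * (C * X * B)"
        by (rule assoc_mult_mat[OF Z mult_carrier_mat[OF C X] B])
      ultimately show ?thesis by simp
    qed
    ultimately have "B\<^sup>T * mat_exp (t \<cdot>\<^sub>m A\<^sup>T) * C\<^sup>T * C * mat_exp (t \<cdot>\<^sub>m A) * B = Y\<^sup>T * Y"
      unfolding mat_exp_transpose[OF A] X_def[symmetric] Y_def[symmetric] by simp
    \<comment> \<open>All n^2 entries of \<open>Y\<close> have the same square, which accounts for
      the factor n^2 in the integrand.\<close>
    moreover have "mat_trace (Y\<^sup>T * Y) = (\<Sum>j<n. \<Sum>i<n. (b / m)\<^sup>2 / k * (H t)\<^sup>2)"
      using Y Y_idx by (simp add: mat_trace_gram)
    ultimately show ?thesis by (simp add: power2_eq_square)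
  qed
  have "(\<lambda>t. (H t)\<^sup>2) \<in> borel_measurable borel"
    using H' by (intro borel_measurable_continuous_onI continuous_on_power continuous_at_imp_continuous_on)
      (auto intro: DERIV_isCont)
  then have meas: "(\<lambda>t. ennreal ((H t)\<^sup>2) * indicator {0..} t) \<in> borel_measurable lborel"
    by measurable
  have "h2_norm_sq A B C = (\<integral>\<^sup>+t. ennreal ((real n * b / m)\<^sup>2 / k) * (ennreal ((H t)\<^sup>2) * indicator {0..} t) \<partial>lborel)"
    unfolding h2_norm_sq_def integrand using assms(10) by (simp add: ennreal_mult mult.assoc del: times_divide_eq_left)
  also have "\<dots> = ennreal ((real n * b / m)\<^sup>2 / k) * ennreal (\<delta> / (2 * \<alpha> * \<gamma>))"
    unfolding nn_integral_cmult[OF meas] damped_oscillator_energy[OF pos F' H' init] ..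
  also have "\<dots> = ennreal ((real n * b / m)\<^sup>2 / k * (\<delta> / (2 * \<alpha> * \<gamma>)))"
    using assms(10) pos by (intro ennreal_mult[symmetric]) simp_all
  \<comment> \<open>\<open>\<delta> / (2 * \<alpha> * \<gamma>)\<close> equals m^2 k / (2 n^2 d
    \<tau>), so \<open>n\<close>, \<open>m\<close> and \<open>k\<close> cancel against the
    prefactor.\<close>
  also have "(real n * b / m)\<^sup>2 / k * (\<delta> / (2 * \<alpha> * \<gamma>)) = b\<^sup>2 / (2 * \<tau>) * (1 / d)"
    unfolding \<alpha>_def \<gamma>_def \<delta>_def using assms n by (simp add: field_simps power2_eq_square)
  finally show ?thesis unfolding A_def B_def C_def .
qed

end
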